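(* For all integers $M\ge N\ge 0$ there exists a Markov kernel $\Lambda$ from $\{0,1,\dots,N\}$ to $\{0,1,\dots,M\}$ such that $L_N\Lambda=\Lambda L_M$ and such that $\Lambda$ is surjective as a linear map $f\mapsto \Lambda[f]$ from $\mathbb{R}^{\{0,\dots,M\}}$ to $\mathbb{R}^{\{0,\dots,N\}}$.
   Context: For an integer $N\ge 0$, the Ehrenfest generator $L_N$ is the $\{0,\dots,N\}\times\{0,\dots,N\}$ matrix whose off-diagonal entries are $L_N(x,x+1)=\frac{N-x}{2}$, $L_N(x,x-1)=\frac{x}{2}$, and $L_N(x,x')=0$ for $|x-x'|\ge 2$, and whose diagonal entries are such that all row sums vanish. A Markov kernel from a finite set $W$ to a finite set $V$ is a $W\times V$ matrix with non-negative entries and all row sums equal to $1$; it acts on functions by $\Lambda[f](w)=\sum_{v\in V}\Lambda(w,v)f(v)$. *)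

theory Defs
  imports Complex_Main "Jordan_Normal_Form.Matrix"
begin

(* A set {0, ..., n} indexes rows and columns, so the matrix dimension is n + 1.
   A function on {0, ..., n} is an element of carrier_vec (n + 1), and the action of a
   kernel A on a function f is A *\<^sub>v f. *)

definition ehrenfest_rate :: "nat \<Rightarrow> nat \<Rightarrow> nat \<Rightarrow> real" where
  "ehrenfest_rate N x y =
     (if y = x + 1 then (real N - real x) / 2
      else if x = y + 1 then real x / 2
      else 0)"

definition ehrenfest_generator :: "nat \<Rightarrow> real mat" where
  "ehrenfest_generator N =
     mat (N + 1) (N + 1) (\<lambda>(x, y).
       if x = y then - (\<Sum>z\<in>{0..N} - {x}. ehrenfest_rate N x z)
       else ehrenfest_rate N x y)"

(* Kernel from {0, ..., n - 1} to {0, ..., m - 1}. *)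
definition markov_kernel :: "nat \<Rightarrow> nat \<Rightarrow> real mat \<Rightarrow> bool" where
  "markov_kernel n m A \<longleftrightarrow>
     A \<in> carrier_mat n m \<and>
     (\<forall>i<n. \<forall>j<m. 0 \<le> A $$ (i, j)) \<and>
     (\<forall>i<n. (\<Sum>j<m. A $$ (i, j)) = 1)"

end

theory Submission
  imports Defs
begin

text \<open>
  The number of up-spins among \<open>N\<close> independent spins, each flipping at rate 1/2, is a Markov chain
  with generator \<open>L\<^sub>N\<close>. Adjoining one more independent spin that is stationary, that is up with
  probability 1/2, gives a kernel from \<open>{0, \<dots>, N}\<close> to \<open>{0, \<dots>, N + 1}\<close> which intertwines
  \<open>L\<^sub>N\<close> and \<open>L\<^sub>N\<^sub>+\<^sub>1\<close>; it is bidiagonal with non-zero entries, hence surjective.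
  Composing \<open>M - N\<close> such kernels yields the result.
\<close>

text \<open>The two conditions exclude each other. Adding two indicator terms instead of nesting
  conditionals lets \<open>sum.distrib\<close> split every sum over a row into two single-point
  sums.\<close>

definition add_spin_kernel :: "nat \<Rightarrow> real mat" where
  "add_spin_kernel N =
     mat (N + 1) (N + 2) (\<lambda>(x, y). (if y = x then 1/2 else 0) + (if y = Suc x then 1/2 else 0))"

lemma add_spin_kernel_carrier [simp]: "add_spin_kernel N \<in> carrier_mat (N + 1) (N + 2)"
  by (simp add: add_spin_kernel_def)

lemma ehrenfest_generator_carrier [simp]: "ehrenfest_generator N \<in> carrier_mat (N + 1) (N + 1)"
  by (simp add: ehrenfest_generator_def)

text \<open>Each of the \<open>N\<close> spins flips at rate 1/2, so the up rate and the down rate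
  add up to a total independent of \<open>x\<close>.\<close>

lemma sum_ehrenfest_rate:
  assumes "x \<le> N"
  shows "(\<Sum>z\<in>{0..N} - {x}. ehrenfest_rate N x z) = real N / 2"
proof -
  have "(\<Sum>z\<in>{0..N} - {x}. ehrenfest_rate N x z) = (\<Sum>z\<in>{0..N}. ehrenfest_rate N x z)"
    by (rule sum.mono_neutral_left) (auto simp: ehrenfest_rate_def)
  \<comment> \<open>Both boundaries are harmless: at \<open>x = 0\<close> truncation makes
    \<open>x - 1\<close> equal to 0, but the weight \<open>real x / 2\<close> vanishes; at
    \<open>x = N\<close> the target \<open>x + 1\<close> is out of range, but its weight vanishes
    too.\<close>
  also have "\<dots> = (\<Sum>z\<in>{0..N}. (if z = x + 1 then (real N - real x) / 2 else 0)
                        + (if z = x - 1 then real x / 2 else 0))"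
    by (rule sum.cong) (auto simp: ehrenfest_rate_def)
  also have "\<dots> = real N / 2"
    using assms by (auto simp: sum.distrib add_divide_distrib diff_divide_distrib not_le le_less)
  finally show ?thesis .
qed

lemma ehrenfest_generator_index:
  assumes "x \<le> N" "y \<le> N"
  shows "ehrenfest_generator N $$ (x, y) = (if x = y then - real N / 2 else ehrenfest_rate N x y)"
  using assms by (auto simp: ehrenfest_generator_def sum_ehrenfest_rate)

lemma markov_kernel_one: "markov_kernel n n (1\<^sub>m n)"
  by (auto simp: markov_kernel_def)

lemma markov_kernel_mult:
  assumes A: "markov_kernel n m A" and B: "markov_kernel m k B"
  shows "markov_kernel n k (A * B)"
proof -
  have carrier: "A \<in> carrier_mat n m" "B \<in> carrier_mat m k"
    using A B by (auto simp: markov_kernel_def)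
  have index: "(A * B) $$ (i, j) = (\<Sum>l<m. A $$ (i, l) * B $$ (l, j))" if "i < n" "j < k" for i j
    using that carrier by (auto simp: scalar_prod_def atLeast0LessThan intro!: sum.cong)
  have "(\<Sum>j<k. (A * B) $$ (i, j)) = 1" if i: "i < n" for i
  proof -
    have "(\<Sum>j<k. (A * B) $$ (i, j)) = (\<Sum>j<k. \<Sum>l<m. A $$ (i, l) * B $$ (l, j))"
      using i by (simp add: index)
    also have "\<dots> = (\<Sum>l<m. \<Sum>j<k. A $$ (i, l) * B $$ (l, j))"
      by (rule sum.swap)
    also have "\<dots> = (\<Sum>l<m. A $$ (i, l))"
      using B by (intro sum.cong) (auto simp: markov_kernel_def simp flip: sum_distrib_left)
    finally show ?thesis
      using A i by (simp add: markov_kernel_def)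
  qed
  moreover have "0 \<le> (A * B) $$ (i, j)" if "i < n" "j < k" for i j
    using that A B by (auto simp: index markov_kernel_def intro!: sum_nonneg)
  ultimately show ?thesis
    using carrier by (auto simp: markov_kernel_def)
qed

lemma markov_kernel_add_spin_kernel: "markov_kernel (N + 1) (N + 2) (add_spin_kernel N)"
  unfolding markov_kernel_def by (auto simp: add_spin_kernel_def sum.distrib)

text \<open>Under its fair law the added spin flips up and down with equal weight, so its own
  contributions cancel and only the flips of the \<open>N\<close> original spins remain.\<close>

lemma add_spin_kernel_intertwines:
  "ehrenfest_generator N * add_spin_kernel N = add_spin_kernel N * ehrenfest_generator (N + 1)"
    (is "?L * ?S = ?S * ?L'")
proof (rule eq_matI)
  fix x y assume "x < dim_row (?S * ?L')" "y < dim_col (?S * ?L')"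
  then have x: "x \<le> N" and y: "y \<le> N + 1"
    by (auto simp: add_spin_kernel_def ehrenfest_generator_def)
  have "(?L * ?S) $$ (x, y) = (\<Sum>z = 0..<N + 1. ?L $$ (x, z) * ?S $$ (z, y))"
    using x y by (simp add: scalar_prod_def add_spin_kernel_def ehrenfest_generator_def)
  also have "\<dots> = (\<Sum>z = 0..<N + 1. (if z = y then ?L $$ (x, z) / 2 else 0)
                    + (if Suc z = y then ?L $$ (x, z) / 2 else 0))"
    using y by (intro sum.cong) (auto simp: add_spin_kernel_def)
  \<comment> \<open>The guards matter: \<open>y = N + 1\<close> lies outside \<open>?L\<close>, and
    for \<open>y = 0\<close> truncation would turn \<open>y - 1\<close> into a valid column.\<close>
  also have "\<dots> = (if y \<le> N then ?L $$ (x, y) / 2 else 0)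
                    + (if y > 0 then ?L $$ (x, y - 1) / 2 else 0)"
    using y by (cases y) (auto simp: sum.distrib not_less_eq_eq dest: le_antisym)
  finally have left: "(?L * ?S) $$ (x, y) = \<dots>" .
  have "(?S * ?L') $$ (x, y) = (\<Sum>z = 0..<N + 2. ?S $$ (x, z) * ?L' $$ (z, y))"
    using x y by (simp add: scalar_prod_def add_spin_kernel_def ehrenfest_generator_def)
  also have "\<dots> = (\<Sum>z = 0..<N + 2. (if z = x then ?L' $$ (z, y) / 2 else 0)
                    + (if z = Suc x then ?L' $$ (z, y) / 2 else 0))"
    using x by (intro sum.cong) (auto simp: add_spin_kernel_def)
  also have "\<dots> = ?L' $$ (x, y) / 2 + ?L' $$ (Suc x, y) / 2"
    using x by (simp add: sum.distrib)
  finally have right: "(?S * ?L') $$ (x, y) = \<dots>" .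
  show "(?L * ?S) $$ (x, y) = (?S * ?L') $$ (x, y)"
    \<comment> \<open>On both sides the entries at \<open>y = x - 1\<close>, \<open>x\<close>,
      \<open>x + 1\<close>, \<open>x + 2\<close> are x/4, (x - N)/4, -x/4, (N - x)/4 whenever
      \<open>y\<close> is in range; all others are 0.\<close>
    unfolding left right using x y
    by (auto simp: ehrenfest_generator_index ehrenfest_rate_def field_simps)
qed (auto simp: add_spin_kernel_def ehrenfest_generator_def)

lemma add_spin_kernel_surj:
  "(\<lambda>f. add_spin_kernel N *\<^sub>v f) ` carrier_vec (N + 2) = carrier_vec (N + 1)"
proof (intro equalityI subsetI)
  fix g :: "real vec" assume g: "g \<in> carrier_vec (N + 1)"
  \<comment> \<open>There is one more unknown than equations: the value at 0 is chosen freely as 0,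
    and (f(x) + f(x+1))/2 = g(x) is solved forward for f(x+1).\<close>
  define f where "f = vec (N + 2) (rec_nat 0 (\<lambda>x fx. 2 * g $ x - fx))"
  have "add_spin_kernel N *\<^sub>v f = g"
  proof (rule eq_vecI)
    fix x assume "x < dim_vec g"
    then have x: "x < N + 1" using g by simp
    have "(add_spin_kernel N *\<^sub>v f) $ x = (\<Sum>z = 0..<N + 2. add_spin_kernel N $$ (x, z) * f $ z)"
      using x by (simp add: scalar_prod_def add_spin_kernel_def f_def)
    also have "\<dots> = (\<Sum>z = 0..<N + 2. (if z = x then f $ z / 2 else 0)
                      + (if z = Suc x then f $ z / 2 else 0))"
      using x by (intro sum.cong) (auto simp: add_spin_kernel_def)
    also have "\<dots> = f $ x / 2 + f $ Suc x / 2"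
      using x by (simp add: sum.distrib)
    also have "\<dots> = g $ x"
      using x by (simp add: f_def field_simps)
    finally show "(add_spin_kernel N *\<^sub>v f) $ x = g $ x" .
  qed (use g in \<open>auto simp: add_spin_kernel_def\<close>)
  moreover have "f \<in> carrier_vec (N + 2)" by (simp add: f_def)
  ultimately show "g \<in> (\<lambda>f. add_spin_kernel N *\<^sub>v f) ` carrier_vec (N + 2)" by blast
qed (use mult_mat_vec_carrier[OF add_spin_kernel_carrier] in blast)

theorem mainTheorem1:
  fixes M N :: nat
  assumes "N \<le> M"
  shows "\<exists>\<Lambda> :: real mat.
           markov_kernel (N + 1) (M + 1) \<Lambda> \<and>
           ehrenfest_generator N * \<Lambda> = \<Lambda> * ehrenfest_generator M \<and>
           (\<lambda>f. \<Lambda> *\<^sub>v f) ` carrier_vec (M + 1) = carrier_vec (N + 1)"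
  using assms
proof (induction M rule: dec_induct)
  case base
  have "(\<lambda>f :: real vec. 1\<^sub>m (N + 1) *\<^sub>v f) ` carrier_vec (N + 1) = carrier_vec (N + 1)"
    by (simp cong: image_cong)
  moreover have "ehrenfest_generator N * 1\<^sub>m (N + 1) = 1\<^sub>m (N + 1) * ehrenfest_generator N"
    by (metis ehrenfest_generator_carrier left_mult_one_mat right_mult_one_mat)
  ultimately show ?case using markov_kernel_one by blast
next
  case (step M)
  then obtain \<Lambda> where \<Lambda>: "markov_kernel (N + 1) (M + 1) \<Lambda>"
      "ehrenfest_generator N * \<Lambda> = \<Lambda> * ehrenfest_generator M"
      "(\<lambda>f. \<Lambda> *\<^sub>v f) ` carrier_vec (M + 1) = carrier_vec (N + 1)"
    by blast
  let ?S = "add_spin_kernel M"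
  note S = add_spin_kernel_carrier[of M]
  have carrier: "\<Lambda> \<in> carrier_mat (N + 1) (M + 1)"
    using \<Lambda>(1) by (simp add: markov_kernel_def)
  have gen: "ehrenfest_generator (M + 1) \<in> carrier_mat (M + 2) (M + 2)"
    using ehrenfest_generator_carrier[of "M + 1"] by simp
  have "ehrenfest_generator N * (\<Lambda> * ?S) = ehrenfest_generator N * \<Lambda> * ?S"
    by (rule assoc_mult_mat[symmetric, OF ehrenfest_generator_carrier carrier S])
  also have "\<dots> = \<Lambda> * (ehrenfest_generator M * ?S)"
    unfolding \<Lambda>(2) by (rule assoc_mult_mat[OF carrier ehrenfest_generator_carrier S])
  also have "\<dots> = \<Lambda> * ?S * ehrenfest_generator (M + 1)"
    unfolding add_spin_kernel_intertwines by (rule assoc_mult_mat[symmetric, OF carrier S gen])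
  finally have "ehrenfest_generator N * (\<Lambda> * ?S) = \<Lambda> * ?S * ehrenfest_generator (M + 1)" .
  \<comment> \<open>Associativity turns the action of the product into a composition, so
    surjectivity of the two factors carries over.\<close>
  moreover have "(\<lambda>f. \<Lambda> * ?S *\<^sub>v f) ` carrier_vec (M + 2)
      = (\<lambda>f. \<Lambda> *\<^sub>v f) ` (\<lambda>f. ?S *\<^sub>v f) ` carrier_vec (M + 2)"
    unfolding image_image by (rule image_cong[OF refl assoc_mult_mat_vec[OF carrier S]])
  then have "(\<lambda>f. \<Lambda> * ?S *\<^sub>v f) ` carrier_vec (M + 2) = carrier_vec (N + 1)"
    unfolding add_spin_kernel_surj \<Lambda>(3) .
  moreover note markov_kernel_mult[OF \<Lambda>(1) markov_kernel_add_spin_kernel]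
  ultimately show ?case by auto
qed

end
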